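(* Let $k$ be a nonnegative integer, $\upsilon\in\{1,2,\dots\}$, $q>-1$, $p>k+1$, $z\neq0$, and let $\operatorname{Re}(a)>0$ and $\left|\frac{w^{\upsilon}}{a^{\upsilon}}\right|<1$. Then the Laplace transform in $t$, evaluated at $a$, satisfies $$L\left\{t^{q}\,{}_{K}I_{k;\upsilon}^{(p,q)}(z,wt)\right\}(a)=\frac{(1-p)_{k}(-2z)^{k}}{a^{q+1}}\left(\frac{a^{\upsilon}-w^{\upsilon}}{a^{\upsilon}}\right)^{k}{}_{3}F_{2}\left[\begin{matrix}-k,\frac{-k}{2},\frac{-k+1}{2}\\ -k,\,p-k\end{matrix};\frac{-a^{\upsilon}}{z^{2}(a^{\upsilon}-w^{\upsilon})}\right].$$
   Context: $(a)_n$ is the Pochhammer symbol, $[x]$ the integer part. The Laplace transform is $L\{h\}(a)=\int_0^\infty e^{-a\xi}h(\xi)\,d\xi$, $\operatorname{Re}(a)>0$. The finite bivariate I-Konhauser polynomials are $${}_{K}I_{k;\upsilon}^{(p,q)}(z,t)=(-1)^{k}(1-p)_{k}\sum_{l=0}^{[k/2]}\sum_{n=0}^{k-l}\frac{(-1)^{l}(-k)_{2l}(l-k)_{n}(2z)^{k-2l}t^{\upsilon n}}{(p-k)_{l}\,\Gamma(\upsilon n+q+1)\,n!\,l!}.$$ ${}_3F_2\left[\begin{matrix}\alpha_1,\alpha_2,\alpha_3\\ \beta_1,\beta_2\end{matrix};x\right]=\sum_{l\ge0}\frac{(\alpha_1)_l(\alpha_2)_l(\alpha_3)_l}{(\beta_1)_l(\beta_2)_l}\frac{x^l}{l!}$;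 since one of $-k/2,(-k+1)/2$ is a nonpositive integer, the series is read as terminating at $l=[k/2]$ (where $(-k)_l$ in the denominator is nonzero and cancels the numerator factor $(-k)_l$). *)

theory Defs
  imports "HOL-Analysis.Analysis"
begin

definition I_Konhauser :: "nat \<Rightarrow> nat \<Rightarrow> real \<Rightarrow> real \<Rightarrow> complex \<Rightarrow> complex \<Rightarrow> complex" where
  "I_Konhauser k \<upsilon> p q z t =
     (- 1) ^ k * pochhammer (1 - of_real p) k *
     (\<Sum>l = 0..k div 2. \<Sum>n = 0..k - l.
        ((- 1) ^ l * pochhammer (- of_nat k) (2 * l) * pochhammer (of_nat l - of_nat k) n *
         (2 * z) ^ (k - 2 * l) * t ^ (\<upsilon> * n)) /
        (pochhammer (of_real p - of_nat k) l * Gamma (of_nat (\<upsilon> * n) + of_real q + 1) *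
         fact n * fact l))"

text \<open>
  A term whose numerator and denominator both vanish contributes 0, because \<open>x / 0 = 0\<close>.
  Hence, when a nonpositive integer parameter \<open>- k\<close> occurs both on top and below,
  the series terminates as specified by \<open>hyp3F2_terminating\<close>.
\<close>
definition hyp3F2 ::
    "complex \<Rightarrow> complex \<Rightarrow> complex \<Rightarrow> complex \<Rightarrow> complex \<Rightarrow> complex \<Rightarrow> complex" where
  "hyp3F2 \<alpha>1 \<alpha>2 \<alpha>3 \<beta>1 \<beta>2 x =
     (\<Sum>l. (pochhammer \<alpha>1 l * pochhammer \<alpha>2 l * pochhammer \<alpha>3 l) /
           (pochhammer \<beta>1 l * pochhammer \<beta>2 l) * (x ^ l / fact l))"

lemma hyp3F2_terminating:
  "hyp3F2 (- of_nat k) (- of_nat k / 2) ((- of_nat k + 1) / 2) (- of_nat k) b x =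
     (\<Sum>l = 0..k div 2. pochhammer (- of_nat k / 2) l * pochhammer ((- of_nat k + 1) / 2) l /
           pochhammer b l * (x ^ l / fact l))"
proof -
  define f where "f l = (pochhammer (- of_nat k) l * pochhammer (- of_nat k / 2) l *
      pochhammer ((- of_nat k + 1) / 2) l) / (pochhammer (- of_nat k) l * pochhammer b l) *
      (x ^ l / fact l)" for l
  have zero: "f l = 0" if "l \<notin> {0..k div 2}" for l
  proof (cases "even k")
    case True
    then obtain m where m: "k = 2 * m" by blast
    then have "pochhammer (- of_nat k / 2 :: complex) l = 0"
      using that by (simp add: pochhammer_of_nat_eq_0_iff)
    then show ?thesis by (simp add: f_def)
  next
    case False
    then obtain m where m: "k = 2 * m + 1" using oddE by blast
    then have "(- of_nat k + 1) / 2 = (- of_nat m :: complex)" by simp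
    then have "pochhammer ((- of_nat k + 1) / 2 :: complex) l = 0"
      using that m by (simp only:) (simp add: pochhammer_of_nat_eq_0_iff)
    then show ?thesis by (simp add: f_def)
  qed
  have "suminf f = (\<Sum>l = 0..k div 2. f l)"
    by (rule suminf_finite) (use zero in auto)
  also have "\<dots> = (\<Sum>l = 0..k div 2. pochhammer (- of_nat k / 2) l *
      pochhammer ((- of_nat k + 1) / 2) l / pochhammer b l * (x ^ l / fact l))"
  proof (rule sum.cong[OF refl])
    fix l assume "l \<in> {0..k div 2}"
    then have "\<not> k < l" by auto
    then have "pochhammer (- of_nat k :: complex) l \<noteq> 0"
      by (simp add: pochhammer_of_nat_eq_0_iff)
    then show "f l = pochhammer (- of_nat k / 2) l * pochhammer ((- of_nat k + 1) / 2) l /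
        pochhammer b l * (x ^ l / fact l)"
      by (simp add: f_def)
  qed
  finally show ?thesis by (simp add: hyp3F2_def f_def[abs_def])
qed

definition laplace_integrable :: "(real \<Rightarrow> complex) \<Rightarrow> complex \<Rightarrow> bool" where
  "laplace_integrable h a \<longleftrightarrow>
     set_integrable lborel {0<..} (\<lambda>\<xi>. exp (- a * of_real \<xi>) * h \<xi>)"

definition laplace :: "(real \<Rightarrow> complex) \<Rightarrow> complex \<Rightarrow> complex" where
  "laplace h a = (LINT \<xi>:{0<..}|lborel. exp (- a * of_real \<xi>) * h \<xi>)"

end

theory Submission
  imports Defs
begin

text \<open>
  The polynomial is a finite sum of monomials in \<open>w t\<close>, and the Laplace transform of
  \<open>t\<^sup>q (w t)\<^sup>m / \<Gamma>(m + q + 1)\<close> is \<open>(w / a)\<^sup>m / a\<^bsup>q + 1\<^esup>\<close>: the Gamma factor in the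
  coefficients of the polynomial is exactly the one that the integral produces
  (\<open>has_bochner_integral_laplace_monomial\<close>). Only powers of \<open>x = (w / a)\<^sup>\<upsilon>\<close> remain, so for each
  \<open>l\<close> the inner sum collapses by the binomial theorem to \<open>(1 - x)\<^bsup>k - l\<^esup>\<close>
  (\<open>sum_pochhammer_neg_power\<close>). In the outer sum the duplication formula
  \<open>(-k)\<^bsub>2l\<^esub> = 4\<^sup>l (-k/2)\<^sub>l ((1-k)/2)\<^sub>l\<close> produces the hypergeometric parameters, and the
  factors \<open>(2 z)\<^sup>k (1 - x)\<^sup>k\<close> come out in front; dividing by powers of \<open>1 - x\<close> is what
  requires \<open>w\<^sup>\<upsilon> \<noteq> a\<^sup>\<upsilon>\<close>.

  The analytic content is \<open>\<integral>\<^sub>0\<^sup>\<infinity> e\<^bsup>-a t\<^esup> t\<^bsup>s - 1\<^esup> dt = \<Gamma>(s) / a\<^sup>s\<close> for complex \<open>a\<close> with positive real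
  part (\<open>has_bochner_integral_laplace_powr\<close>). For real \<open>a = c > 0\<close> this is Euler's integral after
  a substitution. For complex \<open>a\<close> no contour is rotated: choose a real \<open>c\<close> with
  \<open>\<bar>c - a\<bar> < c\<close>, write \<open>e\<^bsup>-a t\<^esup> = e\<^bsup>-c t\<^esup> e\<^bsup>(c - a) t\<^esup>\<close>, expand the second factor into its power
  series and integrate term by term. The terms are Euler integrals, and the resulting
  series is the binomial series of \<open>\<Gamma>(s) c\<^bsup>-s\<^esup> (a / c)\<^bsup>-s\<^esup>\<close>, which converges absolutely by the choice
  of \<open>c\<close>.
\<close>

section \<open>The Laplace transform of a power\<close>

lemma has_bochner_integral_Gamma_scaled:
  fixes s c :: real
  assumes "s > 0" "c > 0"
  shows "has_bochner_integral lborel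
           (\<lambda>t. indicator {0<..} t * (t powr (s - 1) * exp (- c * t))) (Gamma s / c powr s)"
proof -
  define g :: "real \<Rightarrow> real \<Rightarrow> real"
    where "g c t = indicator {0<..} t * (t powr (s - 1) * exp (- c * t))" for c t
  have "(\<integral>\<^sup>+t. ennreal (g 1 t) \<partial>lborel) =
        (\<integral>\<^sup>+t. ennreal (indicator {0..} t * t powr (s - 1) / exp t) \<partial>lborel)"
    by (intro nn_integral_cong) (auto simp: g_def indicator_def exp_minus field_simps)
  then have "(\<integral>\<^sup>+t. ennreal (g 1 t) \<partial>lborel) = ennreal (Gamma s)"
    using Gamma_conv_nn_integral_real[OF \<open>s > 0\<close>] by simp
  moreover have "g 1 \<in> borel_measurable borel"
    unfolding g_def[abs_def] by measurable
  ultimately have "has_bochner_integral lborel (g 1) (Gamma s)"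
    using assms Gamma_real_pos[of s]
    by (intro has_bochner_integral_nn_integral) (auto simp: g_def)
  then have "has_bochner_integral lborel (\<lambda>t. g 1 (0 + c * t)) (Gamma s /\<^sub>R \<bar>c\<bar>)"
    using assms by (subst (asm) lborel_has_bochner_integral_real_affine_iff[of c _ _ 0]) auto
  then have "has_bochner_integral lborel (\<lambda>t. g 1 (0 + c * t) / c powr (s - 1))
               (Gamma s /\<^sub>R \<bar>c\<bar> / c powr (s - 1))"
    by (rule has_bochner_integral_divide_zero)
  moreover have "g 1 (0 + c * t) / c powr (s - 1) = g c t" for t
    using assms by (auto simp: g_def indicator_def powr_mult zero_less_mult_iff)
  moreover have "Gamma s /\<^sub>R \<bar>c\<bar> / c powr (s - 1) = Gamma s / c powr s"
    using assms by (simp add: powr_diff field_simps)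
  ultimately show ?thesis
    by (simp add: g_def)
qed

text \<open>
  The right half-plane is the union of the discs that touch the imaginary axis at \<open>0\<close>.
  These are the discs on which the binomial series around a real centre \<open>c\<close> converges.
\<close>

lemma half_plane_point_in_tangent_disc:
  fixes a :: complex
  assumes "Re a > 0"
  obtains c where "c > 0" "norm (of_real c - a) < c"
proof -
  \<comment> \<open>The condition is equivalent to \<open>(norm a)\<^sup>2 < 2 c Re a\<close>; this \<open>c\<close> is twice the critical value.\<close>
  define c where "c = (norm a)\<^sup>2 / Re a"
  have "a \<noteq> 0" using assms by auto
  then have c: "c > 0" using assms by (simp add: c_def)
  have "(norm (of_real c - a))\<^sup>2 = c\<^sup>2 - 2 * c * Re a + (norm a)\<^sup>2"
    unfolding cmod_power2 by (simp add: power2_eq_square algebra_simps)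
  also have "2 * c * Re a = 2 * (norm a)\<^sup>2"
    using assms by (simp add: c_def)
  also have "c\<^sup>2 - 2 * (norm a)\<^sup>2 + (norm a)\<^sup>2 < c\<^sup>2"
    using \<open>a \<noteq> 0\<close> by simp
  finally have "norm (of_real c - a) < c"
    using c by (intro power2_less_imp_less[of _ c]) auto
  with c that show ?thesis by blast
qed

text \<open>
  Termwise integration needs the integrals of the absolute values of the terms to be summable.
  They are, up to the factor \<open>\<Gamma>(s) / c\<^sup>s\<close>, the terms of the binomial series of
  \<open>(1 - r)\<^bsup>-s\<^esup>\<close> with \<open>r = \<bar>c - a\<bar> / c < 1\<close>, all of which are nonnegative.
\<close>

lemma has_bochner_integral_laplace_powr:
  fixes s :: real and a :: complex
  assumes s: "s > 0" and a: "Re a > 0"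
  shows "has_bochner_integral lborel
           (\<lambda>t. indicator {0<..} t *\<^sub>R (exp (- a * of_real t) * of_real (t powr (s - 1))))
           (Gamma (of_real s) / a powr of_real s)"
proof -
  obtain c where c: "c > 0" and ac: "norm (of_real c - a) < c"
    using half_plane_point_in_tangent_disc[OF a] .
  define b where "b = of_real c - a"
  define r where "r = norm b / c"
  have r: "0 \<le> r" "r < 1" using c ac by (auto simp: r_def b_def)
  define g where "g n t = indicator {0<..} t * (t powr (s + real n - 1) * exp (- c * t))"
    for n and t :: real
  define f where "f n t = of_real (g n t) * (b ^ n / fact n)" for n t
  have g_nonneg: "g n t \<ge> 0" for n t by (simp add: g_def)
  have int_g: "has_bochner_integral lborel (g n) (Gamma s / c powr s * (pochhammer s n / c ^ n))" for n
  proof -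
    have "has_bochner_integral lborel (g n) (Gamma (s + real n) / c powr (s + real n))"
      unfolding g_def by (rule has_bochner_integral_Gamma_scaled) (use s c in auto)
    moreover have "Gamma (s + real n) = pochhammer s n * Gamma s"
      using s by (subst pochhammer_Gamma) (auto elim!: nonpos_Ints_cases simp: Gamma_eq_zero_iff)
    ultimately show ?thesis
      using c by (simp add: powr_add powr_realpow field_simps)
  qed
  have int_f: "has_bochner_integral lborel (f n)
      (of_real (Gamma s / c powr s * (pochhammer s n / c ^ n)) * (b ^ n / fact n))" for n
    unfolding f_def by (intro has_bochner_integral_mult_left has_bochner_integral_of_real int_g)
  have int_norm: "(\<integral>t. norm (f n t) \<partial>lborel) =
      Gamma s / c powr s * (((- s) gchoose n) * (- r) ^ n)" for n
  proof -
    have "has_bochner_integral lborel (\<lambda>t. g n t * (norm b ^ n / fact n))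
        (Gamma s / c powr s * (pochhammer s n / c ^ n) * (norm b ^ n / fact n))"
      by (intro has_bochner_integral_mult_left int_g)
    moreover have "norm (f n t) = g n t * (norm b ^ n / fact n)" for t
      using g_nonneg[of n t] by (simp add: f_def norm_mult norm_divide norm_power)
    ultimately have "(\<integral>t. norm (f n t) \<partial>lborel) =
        Gamma s / c powr s * (pochhammer s n / c ^ n) * (norm b ^ n / fact n)"
      by (simp add: has_bochner_integral_iff)
    also have "\<dots> = Gamma s / c powr s * (((- s) gchoose n) * (- r) ^ n)"
    proof -
      have "(- r) ^ n = (- 1) ^ n * (norm b ^ n / c ^ n)"
        unfolding r_def by (simp add: power_minus[of "_ / _"] power_divide)
      then show ?thesis
        by (simp add: gbinomial_pochhammer mult_ac)
    qed
    finally show ?thesis .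
  qed
  have f_sums: "(\<lambda>n. f n t) sums
      (indicator {0<..} t *\<^sub>R (exp (- a * of_real t) * of_real (t powr (s - 1))))" for t
  proof (cases "t > 0")
    case True
    have "(\<lambda>n. (b * of_real t) ^ n /\<^sub>R fact n) sums exp (b * of_real t)"
      by (rule exp_converges)
    then have "(\<lambda>n. of_real (t powr (s - 1) * exp (- c * t)) * ((b * of_real t) ^ n /\<^sub>R fact n)) sums
        (of_real (t powr (s - 1) * exp (- c * t)) * exp (b * of_real t))"
      by (rule sums_mult)
    moreover have "of_real (t powr (s - 1) * exp (- c * t)) * ((b * of_real t) ^ n /\<^sub>R fact n) = f n t" for n
    proof -
      have "t powr (s + real n - 1) = t powr (s - 1) * t ^ n"
        using True by (simp add: powr_realpow[symmetric] powr_add[symmetric] algebra_simps)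
      then show ?thesis using True
        by (simp add: f_def g_def scaleR_conv_of_real power_mult_distrib field_simps)
    qed
    moreover have "of_real (exp (- c * t)) * exp (b * of_real t) = exp (- a * of_real t)"
      by (simp add: b_def exp_of_real[symmetric] exp_add[symmetric] algebra_simps)
    ultimately show ?thesis using True
      by (simp add: mult.assoc) (simp add: mult.commute)
  qed (simp add: f_def g_def)
  have summable_norm_f: "summable (\<lambda>n. norm (f n t))" for t
  proof -
    have "(\<lambda>n. norm (f n t)) = (\<lambda>n. indicator {0<..} t * (t powr (s - 1) * exp (- c * t)) *
            ((norm b * t) ^ n /\<^sub>R fact n))"
    proof
      fix n
      show "norm (f n t) = indicator {0<..} t * (t powr (s - 1) * exp (- c * t)) *
            ((norm b * t) ^ n /\<^sub>R fact n)"
      proof (cases "t > 0")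
        case True
        then have "t powr (s + real n - 1) = t powr (s - 1) * t ^ n"
          by (simp add: powr_realpow[symmetric] powr_add[symmetric] algebra_simps)
        then show ?thesis using True
          by (simp add: f_def g_def norm_mult norm_divide norm_power power_mult_distrib field_simps)
      qed (simp add: f_def g_def)
    qed
    then show ?thesis
      by (simp only:) (intro summable_mult summable_exp_generic)
  qed
  have "summable (\<lambda>n. \<integral>t. norm (f n t) \<partial>lborel)"
    unfolding int_norm using gen_binomial_real[of "- r" "- s"] r
    by (intro summable_mult) (auto simp: sums_iff)
  moreover have "integrable lborel (f n)" for n
    using int_f by (simp add: has_bochner_integral_iff)
  ultimately have integrable: "integrable lborel (\<lambda>t. \<Sum>n. f n t)"
      and sums: "(\<lambda>n. integral\<^sup>L lborel (f n)) sums (\<integral>t. (\<Sum>n. f n t) \<partial>lborel)"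
    using summable_norm_f by (auto intro!: integrable_suminf sums_integral)
  have a_over_c: "a / of_real c - 1 = - (b / of_real c)"
    using c by (simp add: b_def field_simps)
  have integral_f: "integral\<^sup>L lborel (f n) = of_real (Gamma s / c powr s) *
      (((- of_real s) gchoose n) * (a / of_real c - 1) ^ n)" for n
  proof -
    have "(a / of_real c - 1) ^ n = (- 1) ^ n * (b ^ n / of_real c ^ n)"
      unfolding a_over_c by (simp add: power_minus[of "_ / _"] power_divide)
    then show ?thesis
      using int_f[of n]
      by (simp add: has_bochner_integral_iff gbinomial_pochhammer pochhammer_of_real mult_ac)
  qed
  have "(\<lambda>n. of_real (Gamma s / c powr s) *
      (((- of_real s) gchoose n) * (a / of_real c - 1) ^ n)) sums
      (of_real (Gamma s / c powr s) * (1 + (a / of_real c - 1)) powr (- of_real s))"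
  proof (intro sums_mult gen_binomial_complex)
    show "norm (a / of_real c - 1) < 1"
      unfolding a_over_c using r c by (simp add: r_def norm_divide)
  qed
  \<comment> \<open>For a positive real \<open>c\<close> the principal logarithm satisfies \<open>Ln (a / c) = Ln a - ln c\<close>,
    so the powers combine without a change of branch.\<close>
  also have "of_real (Gamma s / c powr s) * (1 + (a / of_real c - 1)) powr (- of_real s) =
      Gamma (of_real s) / a powr of_real s"
  proof -
    have "a \<noteq> 0" using a by auto
    then have "a powr of_real s = of_real c powr of_real s * (a / of_real c) powr of_real s"
      using c by (simp add: powr_def Ln_divide_of_real Ln_of_real exp_add[symmetric] algebra_simps)
    then show ?thesis
      using c by (simp add: powr_minus Gamma_complex_of_real powr_of_real field_simps)
  qed
  finally have "(\<integral>t. (\<Sum>n. f n t) \<partial>lborel) = Gamma (of_real s) / a powr of_real s"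
    using sums unfolding integral_f by (rule sums_unique2[symmetric])
  with integrable show ?thesis
    unfolding has_bochner_integral_iff sums_unique[OF f_sums, symmetric] by blast
qed

section \<open>The Laplace transform of the polynomial\<close>

text \<open>
  The binomial theorem in hypergeometric form: \<open>(-m)\<^sub>n / n!\<close> is \<open>(-1)\<^sup>n\<close> times a binomial
  coefficient.
\<close>

lemma sum_pochhammer_neg_power:
  fixes x :: "'a::field_char_0"
  shows "(\<Sum>n = 0..m. pochhammer (- of_nat m) n * x ^ n / fact n) = (1 - x) ^ m"
proof -
  have "(1 - x) ^ m = (\<Sum>n\<le>m. of_nat (m choose n) * (- x) ^ n)"
    using binomial_ring[of "- x" 1 m] by simp
  also have "\<dots> = (\<Sum>n = 0..m. pochhammer (- of_nat m) n * x ^ n / fact n)"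
    by (intro sum.cong)
       (auto simp: binomial_gbinomial gbinomial_pochhammer power_minus[of x] atMost_atLeast0)
  finally show ?thesis ..
qed

text \<open>
  The normalisation by \<open>\<Gamma>(m + q + 1)\<close> makes the transform geometric in \<open>m\<close>, which is what turns
  the inner sum of the polynomial into a binomial expansion in \<open>(w / a)\<^sup>\<upsilon>\<close>.
\<close>

lemma has_bochner_integral_laplace_monomial:
  fixes q :: real and w a :: complex
  assumes q: "q > - 1" and a: "Re a > 0"
  shows "has_bochner_integral lborel
     (\<lambda>t. indicator {0<..} t *\<^sub>R (exp (- a * of_real t) *
        (of_real (t powr q) * ((w * of_real t) ^ m / Gamma (of_nat m + of_real q + 1)))))
     ((w / a) ^ m / a powr (of_real q + 1))"
proof -
  define s where "s = real m + q + 1"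
  have s: "s > 0" using q by (simp add: s_def)
  have a0: "a \<noteq> 0" using a by auto
  have Gs: "Gamma (of_real s :: complex) \<noteq> 0"
    using s Gamma_real_pos[of s] by (simp add: Gamma_complex_of_real less_imp_neq[symmetric])
  have "has_bochner_integral lborel
     (\<lambda>t. indicator {0<..} t *\<^sub>R (exp (- a * of_real t) * of_real (t powr (s - 1))) *
        (w ^ m / Gamma (of_real s)))
     (Gamma (of_real s) / a powr of_real s * (w ^ m / Gamma (of_real s)))"
    by (intro has_bochner_integral_mult_left has_bochner_integral_laplace_powr s a)
  moreover have "indicator {0<..} t *\<^sub>R (exp (- a * of_real t) * of_real (t powr (s - 1))) *
        (w ^ m / Gamma (of_real s)) = indicator {0<..} t *\<^sub>R (exp (- a * of_real t) *
        (of_real (t powr q) * ((w * of_real t) ^ m / Gamma (of_nat m + of_real q + 1))))" for t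
  proof (cases "t > 0")
    case True
    then have "t powr (s - 1) = t powr q * t ^ m"
      by (simp add: s_def powr_realpow[symmetric] powr_add[symmetric] algebra_simps)
    then show ?thesis using True
      by (simp add: s_def power_mult_distrib)
  qed simp
  moreover have "a powr of_real s = a ^ m * a powr (of_real q + 1)"
    using a0 by (simp add: s_def powr_add add.assoc powr_nat')
  then have "Gamma (of_real s) / a powr of_real s * (w ^ m / Gamma (of_real s)) =
      (w / a) ^ m / a powr (of_real q + 1)"
    using Gs by (simp add: power_divide)
  ultimately show ?thesis by simp
qed

text \<open>
  Linearity over the double sum. The factor \<open>(l - k)\<^sub>n\<close> is \<open>(-(k - l))\<^sub>n\<close>, so the sum over \<open>n\<close>
  is a full binomial expansion with exponent \<open>k - l\<close>.
\<close>

lemma has_bochner_integral_laplace_I_Konhauser: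
  fixes q :: real and w a :: complex
  assumes q: "q > - 1" and a: "Re a > 0"
  shows "has_bochner_integral lborel
     (\<lambda>t. indicator {0<..} t *\<^sub>R (exp (- a * of_real t) *
        (of_real (t powr q) * I_Konhauser k \<upsilon> p q z (w * of_real t))))
     ((- 1) ^ k * pochhammer (1 - of_real p) k / a powr (of_real q + 1) *
      (\<Sum>l = 0..k div 2. (- 1) ^ l * pochhammer (- of_nat k) (2 * l) * (2 * z) ^ (k - 2 * l) /
         (pochhammer (of_real p - of_nat k) l * fact l) * (1 - (w / a) ^ \<upsilon>) ^ (k - l)))"
proof -
  define A where "A l n = (- 1) ^ k * pochhammer (1 - of_real p) k *
      ((- 1) ^ l * pochhammer (- of_nat k) (2 * l) * pochhammer (of_nat l - of_nat k) n *
       (2 * z) ^ (k - 2 * l) / (pochhammer (of_real p - of_nat k) l * fact n * fact l))" for l n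
  define E where "E m t = indicator {0<..} t *\<^sub>R (exp (- a * of_real t) *
        (of_real (t powr q) * ((w * of_real t) ^ m / Gamma (of_nat m + of_real q + 1))))" for m t
  have "has_bochner_integral lborel (\<lambda>t. \<Sum>l = 0..k div 2. \<Sum>n = 0..k - l. A l n * E (\<upsilon> * n) t)
     (\<Sum>l = 0..k div 2. \<Sum>n = 0..k - l. A l n * ((w / a) ^ (\<upsilon> * n) / a powr (of_real q + 1)))"
    unfolding E_def
    by (intro has_bochner_integral_sum has_bochner_integral_mult_right
          has_bochner_integral_laplace_monomial q a)
  moreover have "(\<Sum>l = 0..k div 2. \<Sum>n = 0..k - l. A l n * E (\<upsilon> * n) t) =
      indicator {0<..} t *\<^sub>R (exp (- a * of_real t) *
        (of_real (t powr q) * I_Konhauser k \<upsilon> p q z (w * of_real t)))" for t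
    unfolding I_Konhauser_def A_def E_def scaleR_conv_of_real sum_distrib_left
    by (intro sum.cong refl) (simp add: mult_ac)
  moreover have "(\<Sum>n = 0..k - l. A l n * ((w / a) ^ (\<upsilon> * n) / a powr (of_real q + 1))) =
      (- 1) ^ k * pochhammer (1 - of_real p) k / a powr (of_real q + 1) *
      ((- 1) ^ l * pochhammer (- of_nat k) (2 * l) * (2 * z) ^ (k - 2 * l) /
         (pochhammer (of_real p - of_nat k) l * fact l) * (1 - (w / a) ^ \<upsilon>) ^ (k - l))"
    if "l \<in> {0..k div 2}" for l
  proof -
    have "l \<le> k" using that by auto
    then have "of_nat l - of_nat k = (- of_nat (k - l) :: complex)"
      by (simp add: of_nat_diff)
    then show ?thesis
      unfolding sum_pochhammer_neg_power[symmetric] A_def sum_distrib_left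
      by (intro sum.cong refl, simp only: power_mult) (simp add: mult_ac)
  qed
  ultimately show ?thesis
    by (simp add: sum_distrib_left)
qed

theorem corollary19:
  fixes k \<upsilon> :: nat and p q :: real and z w a :: complex
  assumes "\<upsilon> \<ge> 1" and "q > - 1" and "p > real k + 1" and "z \<noteq> 0"
    and "Re a > 0" and "norm (w ^ \<upsilon> / a ^ \<upsilon>) < 1"
  shows "laplace_integrable (\<lambda>t. of_real (t powr q) * I_Konhauser k \<upsilon> p q z (w * of_real t)) a \<and>
    laplace (\<lambda>t. of_real (t powr q) * I_Konhauser k \<upsilon> p q z (w * of_real t)) a =
      pochhammer (1 - of_real p) k * (- 2 * z) ^ k / a powr (of_real q + 1) *
      ((a ^ \<upsilon> - w ^ \<upsilon>) / a ^ \<upsilon>) ^ k *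
      hyp3F2 (- of_nat k) (- of_nat k / 2) ((- of_nat k + 1) / 2)
             (- of_nat k) (of_real p - of_nat k)
             (- (a ^ \<upsilon>) / (z\<^sup>2 * (a ^ \<upsilon> - w ^ \<upsilon>)))"
proof -
  define y where "y = 1 - (w / a) ^ \<upsilon>"
  have "a \<noteq> 0" using assms(5) by auto
  have "(w / a) ^ \<upsilon> \<noteq> 1" using assms(6) by (auto simp flip: power_divide)
  then have "y \<noteq> 0" by (simp add: y_def)
  have y: "(a ^ \<upsilon> - w ^ \<upsilon>) / a ^ \<upsilon> = y"
    using \<open>a \<noteq> 0\<close> by (simp add: y_def power_divide diff_divide_distrib)
  then have "a ^ \<upsilon> - w ^ \<upsilon> = a ^ \<upsilon> * y"
    using \<open>a \<noteq> 0\<close> by (simp add: field_simps)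
  then have x: "- (a ^ \<upsilon>) / (z\<^sup>2 * (a ^ \<upsilon> - w ^ \<upsilon>)) = - 1 / (z\<^sup>2 * y)"
    using \<open>a \<noteq> 0\<close> by simp
  \<comment> \<open>Duplication gives \<open>4\<^sup>l\<close>, which cancels against \<open>(2 z)\<^bsup>k - 2l\<^esup> = (2 z)\<^sup>k / (4\<^sup>l z\<^bsup>2l\<^esup>)\<close>;
    what is left of the \<open>l\<close>-th powers is the argument \<open>- 1 / (z\<^sup>2 y)\<close>.\<close>
  have summand: "(- 1) ^ l * pochhammer (- of_nat k) (2 * l) * (2 * z) ^ (k - 2 * l) /
         (pochhammer (of_real p - of_nat k) l * fact l) * y ^ (k - l) =
      (2 * z) ^ k * y ^ k *
        (pochhammer (- of_nat k / 2) l * pochhammer ((- of_nat k + 1) / 2) l /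
           pochhammer (of_real p - of_nat k) l * ((- 1 / (z\<^sup>2 * y)) ^ l / fact l))"
    if "l \<in> {0..k div 2}" for l
  proof -
    have l: "2 * l \<le> k" "l \<le> k" using that by auto
    have "(- of_nat k + 1) / 2 = - of_nat k / 2 + (1 / 2 :: complex)"
      by (simp add: add_divide_distrib)
    then have "pochhammer (- of_nat k :: complex) (2 * l) =
        4 ^ l * pochhammer (- of_nat k / 2) l * pochhammer ((- of_nat k + 1) / 2) l"
      using pochhammer_double[of "- of_nat k / 2 :: complex" l]
      by (simp only:) (simp add: power_mult)
    moreover have "(2 * z) ^ (k - 2 * l) = (2 * z) ^ k / (4 ^ l * (z\<^sup>2) ^ l)"
      using l \<open>z \<noteq> 0\<close> by (simp add: power_diff power_mult power_mult_distrib)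
    moreover have "y ^ (k - l) = y ^ k / y ^ l"
      using l \<open>y \<noteq> 0\<close> by (simp add: power_diff)
    moreover have "(- 1 / (z\<^sup>2 * y)) ^ l = (- 1) ^ l / ((z\<^sup>2) ^ l * y ^ l)"
      by (simp only: power_divide power_mult_distrib)
    ultimately show ?thesis by (simp add: mult_ac)
  qed
  have "(\<Sum>l = 0..k div 2. (- 1) ^ l * pochhammer (- of_nat k) (2 * l) * (2 * z) ^ (k - 2 * l) /
         (pochhammer (of_real p - of_nat k) l * fact l) * y ^ (k - l)) =
      (2 * z) ^ k * y ^ k *
      hyp3F2 (- of_nat k) (- of_nat k / 2) ((- of_nat k + 1) / 2)
             (- of_nat k) (of_real p - of_nat k) (- 1 / (z\<^sup>2 * y))"
    unfolding hyp3F2_terminating sum_distrib_left by (intro sum.cong refl summand)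
  moreover have "(- 2 * z) ^ k = (- 1) ^ k * (2 * z) ^ k"
    using power_mult_distrib[of "- 1" "2 * z" k] by simp
  ultimately show ?thesis
    using has_bochner_integral_laplace_I_Konhauser[OF assms(2,5), of k \<upsilon> p z w]
    unfolding laplace_integrable_def laplace_def set_integrable_def set_lebesgue_integral_def
      has_bochner_integral_iff x y y_def[symmetric]
    by simp
qed

end
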